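(* Let $n\ge2$, let $A=[a_{ij}]\in M_n$ be a nonsingular $M$-matrix with $a_{11}=a_{22}=\cdots=a_{nn}$, and let $A^{-1}=[\alpha_{ij}]$ be doubly stochastic. For $t=1,2,\ldots$ put $$\Gamma_t=\frac{2}{\max\limits_{i\neq j}\Big\{\alpha_{ii}+\alpha_{jj}+\Big[(\alpha_{ii}-\alpha_{jj})^2+4\alpha_{ii}\alpha_{jj}\Big(\sum\limits_{k\neq i}p_{ki}^{(t)}\Big)\Big(\sum\limits_{k\neq j}p_{kj}^{(t)}\Big)\Big]^{\frac12}\Big\}},\qquad \Omega_t=\frac{1}{\max\limits_{i\in N}\Big\{\Big(1+\sum\limits_{k\neq i}p_{ki}^{(t)}\Big)\alpha_{ii}\Big\}},$$ $$\widetilde{\Gamma}_t=\frac{2}{\max\limits_{i\neq j}\Big\{\phi_i^{(t)}+\phi_j^{(t)}+\Big[(\phi_{ij}^{(t)})^2+4\phi_{i}^{(t)}\phi_{j}^{(t)}\Big(\sum\limits_{k\neq i}p_{ki}^{(t)}\Big)\Big(\sum\limits_{k\neq j}p_{kj}^{(t)}\Big)\Big]^{\frac12}\Big\}},\qquad \widetilde{\Omega}_t=\frac{1}{\max\limits_{i\in N}\Big\{\Big(1+\sum\limits_{k\neq i}p_{ki}^{(t)}\Big)\phi_i^{(t)}\Big\}}.$$ Then, for every $t=1,2,\ldots$: (a) $\displaystyle \Gamma_t\geq\Omega_t\geq\frac{1}{[1+(n-1)\rho(J_A)]\max_{i\in N}\alpha_{ii}}$; (b) $\displaystyle \Gamma_t\geq\frac{2}{\max\limits_{i\neq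 j}\big\{\alpha_{ii}+\alpha_{jj}+[(\alpha_{ii}-\alpha_{jj})^2+4(n-1)^2\alpha_{ii}\alpha_{jj}\rho(J_A)^2]^{\frac12}\big\}}\geq \frac{1}{[1+(n-1)\rho(J_A)]\max_{i\in N}\alpha_{ii}}$; (c) $\displaystyle \widetilde{\Omega}_t\geq\frac{1}{[1+(n-1)d]\max_{i\in N}\varphi_{i}}$; (d) $\displaystyle \widetilde{\Gamma}_t\geq\frac{2}{\max\limits_{i\neq j}\big\{\varphi_{i}+\varphi_{j}+[\varphi_{ij}^2+4(n-1)^2\varphi_{i}\varphi_{j}d^2]^{\frac12}\big\}}$.
   Context: Let $N=\{1,\ldots,n\}$, $n\ge2$. All indices range over $N$. A matrix is called nonnegative ($\ge 0$) if all its entries are nonnegative. A matrix $A=[a_{ij}]\in\mathbb{R}^{n\times n}$ is a nonsingular $M$-matrix if $a_{ij}\le 0$ for all $i\ne j$ and $A$ is invertible with $A^{-1}\ge 0$; $M_n$ denotes the set of all $n\times n$ nonsingular $M$-matrices. $\rho$ denotes the spectral radius. A matrix is doubly stochastic if it is nonnegative and all its row sums and column sums equal $1$. For $A\in M_n$ with diagonal part $G=\mathrm{diag}(a_{11},\ldots,a_{nn})$, $J_A=G^{-1}(G-A)$ is the Jacobi iterative matrix of $A$. For $A=[a_{ij}]$ with $a_{ii}\ne0$, for $i,j\in N$, $j\ne i$, and $t=1,2,\ldots$, define $$d_i=\frac{\sum_{j\ne i}|a_{ij}|}{|a_{ii}|},\qquad d=\max_{i\in N}d_i,\qquad \varphi_i=\frac{1}{a_{ii}-\sum_{k\ne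 i}|a_{ik}|d_k},\qquad \varphi_{ij}=\max\{\varphi_i,\varphi_j\}-\min\{a_{ii}^{-1},a_{jj}^{-1}\},$$ $$r_i=\max_{j\neq i}\frac{|a_{ji}|}{|a_{jj}|-\sum_{k\ne j,i}|a_{jk}|},\qquad m_{ji}=\frac{|a_{ji}|+\sum_{k\ne j,i}|a_{jk}|r_i}{|a_{jj}|},$$ $$h_i=\max_{j\ne i}\frac{|a_{ji}|}{|a_{jj}|m_{ji}-\sum_{k\ne j,i}|a_{jk}|m_{ki}},\qquad u_{ji}=\frac{|a_{ji}|+\sum_{k\ne j,i}|a_{jk}|m_{ki}h_i}{|a_{jj}|},\qquad u^{(0)}_{ji}=u_{ji},$$ and recursively $$p^{(t)}_{ji}=\frac{|a_{ji}|+\sum_{k\ne j,i}|a_{jk}|u^{(t-1)}_{ki}}{|a_{jj}|},\qquad h^{(t)}_i=\max_{j\ne i}\frac{|a_{ji}|}{|a_{jj}|p^{(t)}_{ji}-\sum_{k\ne j,i}|a_{jk}|p^{(t)}_{ki}},\qquad u^{(t)}_{ji}=\frac{|a_{ji}|+\sum_{k\ne j,i}|a_{jk}|p^{(t)}_{ki}h^{(t)}_i}{|a_{jj}|}.$$ Finally, $$\phi_i^{(t)}=\frac{1}{a_{ii}-\sum_{j\ne i}|a_{ij}|p^{(t)}_{ji}},\qquad \phi_{ij}^{(t)}=\max\{\phi_i^{(t)},\phi_j^{(t)}\}-\min\left\{\frac{1}{a_{ii}-\sum_{k\neq i}\frac{a_{ik}a_{ki}}{a_{kk}}},\ \frac{1}{a_{jj}-\sum_{k\neq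 j}\frac{a_{jk}a_{kj}}{a_{kk}}}\right\}.$$ *)

theory Defs
  imports "Jordan_Normal_Form.Spectral_Radius"
begin

text \<open>Rows and columns are indexed by \<open>{..<n}\<close>, following the matrix library.\<close>

definition nonneg_matrix :: "real mat \<Rightarrow> bool" where
  "nonneg_matrix B \<longleftrightarrow> (\<forall>i<dim_row B. \<forall>j<dim_col B. B $$ (i,j) \<ge> 0)"

definition nonsingular_M_matrices :: "nat \<Rightarrow> real mat set" where
  "nonsingular_M_matrices n = {A \<in> carrier_mat n n.
     (\<forall>i<n. \<forall>j<n. i \<noteq> j \<longrightarrow> A $$ (i,j) \<le> 0) \<and>
     (\<exists>B \<in> carrier_mat n n. inverts_mat A B \<and> inverts_mat B A \<and> nonneg_matrix B)}"

definition doubly_stochastic :: "real mat \<Rightarrow> bool" where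
  "doubly_stochastic B \<longleftrightarrow> nonneg_matrix B \<and>
     (\<forall>i<dim_row B. (\<Sum>j<dim_col B. B $$ (i,j)) = 1) \<and>
     (\<forall>j<dim_col B. (\<Sum>i<dim_row B. B $$ (i,j)) = 1)"

text \<open>With \<open>G\<close> the diagonal part of \<open>A\<close>, this is \<open>G\<^sup>-\<^sup>1 (G - A)\<close>, where \<open>G\<^sup>-\<^sup>1\<close> is
  written as the diagonal matrix of the inverted diagonal entries.\<close>

definition jacobi_matrix :: "real mat \<Rightarrow> real mat" where
  "jacobi_matrix A =
     mat_diag (dim_row A) (\<lambda>i. inverse (A $$ (i,i))) *
     (mat_diag (dim_row A) (\<lambda>i. A $$ (i,i)) - A)"

definition real_spectral_radius :: "real mat \<Rightarrow> real" where
  "real_spectral_radius B = spectral_radius (map_mat complex_of_real B)"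

definition d_row :: "real mat \<Rightarrow> nat \<Rightarrow> real" where
  "d_row A i = (\<Sum>j\<in>{..<dim_row A} - {i}. \<bar>A $$ (i,j)\<bar>) / \<bar>A $$ (i,i)\<bar>"

definition d_max :: "real mat \<Rightarrow> real" where
  "d_max A = (MAX i\<in>{..<dim_row A}. d_row A i)"

definition varphi :: "real mat \<Rightarrow> nat \<Rightarrow> real" where
  "varphi A i = 1 / (A $$ (i,i) - (\<Sum>k\<in>{..<dim_row A} - {i}. \<bar>A $$ (i,k)\<bar> * d_row A k))"

definition varphi2 :: "real mat \<Rightarrow> nat \<Rightarrow> nat \<Rightarrow> real" where
  "varphi2 A i j =
     max (varphi A i) (varphi A j) - min (1 / A $$ (i,i)) (1 / A $$ (j,j))"

definition r_col :: "real mat \<Rightarrow> nat \<Rightarrow> real" where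
  "r_col A i = (MAX j\<in>{..<dim_row A} - {i}.
     \<bar>A $$ (j,i)\<bar> / (\<bar>A $$ (j,j)\<bar> - (\<Sum>k\<in>{..<dim_row A} - {j,i}. \<bar>A $$ (j,k)\<bar>)))"

definition m_coeff :: "real mat \<Rightarrow> nat \<Rightarrow> nat \<Rightarrow> real" where
  "m_coeff A j i =
     (\<bar>A $$ (j,i)\<bar> + (\<Sum>k\<in>{..<dim_row A} - {j,i}. \<bar>A $$ (j,k)\<bar> * r_col A i)) / \<bar>A $$ (j,j)\<bar>"

text \<open>The formulas for \<open>h\<^sub>i\<close> and \<open>h\<^sub>i\<^bsup>(t)\<^esup>\<close>, and those for \<open>u\<^sub>j\<^sub>i\<close> and \<open>u\<^sub>j\<^sub>i\<^bsup>(t)\<^esup>\<close>, differ only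
  in the weights they use, \<open>w = m\<close> and \<open>w = p\<^bsup>(t)\<^esup>\<close> respectively; each pair is written once,
  with \<open>w\<close> as a parameter. Likewise \<open>p_coeff A u\<close> is \<open>p\<^bsup>(t)\<^esup>\<close> for \<open>u = u\<^bsup>(t-1)\<^esup>\<close>.\<close>

text \<open>The quotients in \<open>h_col\<close> may be of the form \<open>0 / 0\<close> (for instance when \<open>A\<close> is
  diagonal); the library convention \<open>x / 0 = 0\<close> assigns them the value \<open>0\<close>.\<close>

definition h_col :: "real mat \<Rightarrow> (nat \<Rightarrow> nat \<Rightarrow> real) \<Rightarrow> nat \<Rightarrow> real" where
  "h_col A w i = (MAX j\<in>{..<dim_row A} - {i}.
     \<bar>A $$ (j,i)\<bar> /
     (\<bar>A $$ (j,j)\<bar> * w j i - (\<Sum>k\<in>{..<dim_row A} - {j,i}. \<bar>A $$ (j,k)\<bar> * w k i)))"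

definition u_coeff :: "real mat \<Rightarrow> (nat \<Rightarrow> nat \<Rightarrow> real) \<Rightarrow> nat \<Rightarrow> nat \<Rightarrow> real" where
  "u_coeff A w j i =
     (\<bar>A $$ (j,i)\<bar> + (\<Sum>k\<in>{..<dim_row A} - {j,i}. \<bar>A $$ (j,k)\<bar> * w k i * h_col A w i))
     / \<bar>A $$ (j,j)\<bar>"

definition p_coeff :: "real mat \<Rightarrow> (nat \<Rightarrow> nat \<Rightarrow> real) \<Rightarrow> nat \<Rightarrow> nat \<Rightarrow> real" where
  "p_coeff A u j i =
     (\<bar>A $$ (j,i)\<bar> + (\<Sum>k\<in>{..<dim_row A} - {j,i}. \<bar>A $$ (j,k)\<bar> * u k i)) / \<bar>A $$ (j,j)\<bar>"

primrec u_iter :: "real mat \<Rightarrow> nat \<Rightarrow> nat \<Rightarrow> nat \<Rightarrow> real" where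
  "u_iter A 0 = u_coeff A (m_coeff A)"
| "u_iter A (Suc t) = u_coeff A (p_coeff A (u_iter A t))"

text \<open>Only meaningful for \<open>t \<ge> 1\<close>, because of the truncated subtraction.\<close>

definition p_iter :: "real mat \<Rightarrow> nat \<Rightarrow> nat \<Rightarrow> nat \<Rightarrow> real" where
  "p_iter A t = p_coeff A (u_iter A (t - 1))"

definition phi :: "real mat \<Rightarrow> nat \<Rightarrow> nat \<Rightarrow> real" where
  "phi A t i =
     1 / (A $$ (i,i) - (\<Sum>j\<in>{..<dim_row A} - {i}. \<bar>A $$ (i,j)\<bar> * p_iter A t j i))"

definition phi2 :: "real mat \<Rightarrow> nat \<Rightarrow> nat \<Rightarrow> nat \<Rightarrow> real" where
  "phi2 A t i j = max (phi A t i) (phi A t j) -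
     min (1 / (A $$ (i,i) - (\<Sum>k\<in>{..<dim_row A} - {i}. A $$ (i,k) * A $$ (k,i) / A $$ (k,k))))
         (1 / (A $$ (j,j) - (\<Sum>k\<in>{..<dim_row A} - {j}. A $$ (j,k) * A $$ (k,j) / A $$ (k,k))))"

definition distinct_pairs :: "nat \<Rightarrow> (nat \<times> nat) set" where
  "distinct_pairs n = {(i,j). i < n \<and> j < n \<and> i \<noteq> j}"

text \<open>In \<open>Gamma_bound\<close> and \<open>Omega_bound\<close> the argument \<open>B\<close> stands for \<open>A\<^sup>-\<^sup>1\<close>.\<close>

definition Gamma_bound :: "real mat \<Rightarrow> real mat \<Rightarrow> nat \<Rightarrow> real" where
  "Gamma_bound A B t = 2 / (MAX (i,j)\<in>distinct_pairs (dim_row A).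
     B $$ (i,i) + B $$ (j,j) +
     sqrt ((B $$ (i,i) - B $$ (j,j))\<^sup>2 +
           4 * B $$ (i,i) * B $$ (j,j) *
           (\<Sum>k\<in>{..<dim_row A} - {i}. p_iter A t k i) *
           (\<Sum>k\<in>{..<dim_row A} - {j}. p_iter A t k j)))"

definition Omega_bound :: "real mat \<Rightarrow> real mat \<Rightarrow> nat \<Rightarrow> real" where
  "Omega_bound A B t = 1 / (MAX i\<in>{..<dim_row A}.
     (1 + (\<Sum>k\<in>{..<dim_row A} - {i}. p_iter A t k i)) * B $$ (i,i))"

definition Gamma_tilde :: "real mat \<Rightarrow> nat \<Rightarrow> real" where
  "Gamma_tilde A t = 2 / (MAX (i,j)\<in>distinct_pairs (dim_row A).
     phi A t i + phi A t j +
     sqrt ((phi2 A t i j)\<^sup>2 +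
           4 * phi A t i * phi A t j *
           (\<Sum>k\<in>{..<dim_row A} - {i}. p_iter A t k i) *
           (\<Sum>k\<in>{..<dim_row A} - {j}. p_iter A t k j)))"

definition Omega_tilde :: "real mat \<Rightarrow> nat \<Rightarrow> real" where
  "Omega_tilde A t = 1 / (MAX i\<in>{..<dim_row A}.
     (1 + (\<Sum>k\<in>{..<dim_row A} - {i}. p_iter A t k i)) * phi A t i)"

end

theory Submission
  imports Defs
begin

text \<open>
  Every inequality compares reciprocals of maxima, and each is obtained by comparing the
  expressions under the maximum pointwise.

  Since \<open>A\<^sup>-\<^sup>1\<close> fixes the all-ones vector \<open>e\<close>, so does \<open>A\<close>; as its off-diagonal entries are
  nonpositive, \<open>a\<^sub>i\<^sub>i = 1 + \<Sum>\<^sub>j\<^sub>\<noteq>\<^sub>i \<bar>a\<^sub>i\<^sub>j\<bar>\<close>, and \<open>A\<close> is strictly diagonally dominant by rows. When the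
  diagonal is constant, all \<open>d\<^sub>i\<close> equal \<open>d\<close>, and \<open>e\<close> is an eigenvector of the Jacobi matrix for the
  eigenvalue \<open>d\<close>. Hence \<open>d \<le> \<rho>(J\<^sub>A)\<close> (\<open>row_sum_le_spectral_radius\<close>).

  Strict diagonal dominance gives \<open>\<bar>a\<^sub>j\<^sub>i\<bar> / \<bar>a\<^sub>j\<^sub>j\<bar> \<le> p\<^sub>j\<^sub>i\<^bsup>(t)\<^esup> \<le> d\<^sub>j\<close> (\<open>p_iter_bounds\<close>): one starts
  from the constant column \<open>r\<^sub>i \<le> 1\<close>, and every later array in the recursion is nonnegative and
  entrywise no larger than the previous one. What makes this work is an invariant of the
  recursion, the supersolution property \<open>dominating_weight\<close>. It follows that
  \<open>\<Sum>\<^sub>k\<^sub>\<noteq>\<^sub>i p\<^sub>k\<^sub>i\<^bsup>(t)\<^esup> \<le> (n - 1) d\<close>, and, by monotonicity of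
  \<open>x \<mapsto> 1 / (a\<^sub>i\<^sub>i - \<Sum> \<bar>a\<^sub>i\<^sub>k\<bar> x\<^sub>k)\<close>, that \<open>\<phi>\<^sub>i\<^bsup>(t)\<^esup> \<le> \<phi>\<^sub>i\<close> and
  \<open>0 \<le> \<phi>\<^sub>i\<^sub>j\<^bsup>(t)\<^esup> \<le> \<phi>\<^sub>i\<^sub>j\<close>, where \<open>\<phi>\<^sub>i\<close> and \<open>\<phi>\<^sub>i\<^sub>j\<close> without a
  superscript stand for \<open>varphi\<close> and \<open>varphi2\<close>.

  The comparisons between a bound of type \<open>\<Gamma>\<close> and one of type \<open>\<Omega>\<close> are the fact that Brauer's
  ovals lie in the union of Gershgorin's discs, in the form of \<open>brauer_root_le\<close>.
\<close>

section \<open>Maxima of Gershgorin and Brauer expressions\<close>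

lemma divide_Max_antimono:
  fixes f g :: "'a \<Rightarrow> real"
  assumes "finite X" "X \<noteq> {}" "0 \<le> c" "\<And>x. x \<in> X \<Longrightarrow> 0 < f x" "\<And>x. x \<in> X \<Longrightarrow> f x \<le> g x"
  shows "c / (MAX x\<in>X. g x) \<le> c / (MAX x\<in>X. f x)"
proof -
  obtain x0 where x0: "x0 \<in> X" using assms(2) by blast
  have "f x \<le> (MAX x\<in>X. g x)" if "x \<in> X" for x
    using assms(5)[OF that] by (rule order_trans) (use that assms(1) in auto)
  hence "(MAX x\<in>X. f x) \<le> (MAX x\<in>X. g x)"
    using assms(1,2) by (subst Max_le_iff) auto
  moreover have "0 < (MAX x\<in>X. f x)"
    using assms(1,4) x0 Max_gr_iff[of "f ` X" 0] by blast
  ultimately show ?thesis using assms(3) by (intro divide_left_mono) auto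
qed

lemma finite_distinct_pairs: "finite (distinct_pairs n)"
  by (rule finite_subset[of _ "{..<n} \<times> {..<n}"]) (auto simp: distinct_pairs_def)

lemma distinct_pairs_nonempty:
  assumes "n \<ge> 2"
  shows "distinct_pairs n \<noteq> {}"
proof -
  have "(0, 1) \<in> distinct_pairs n" using assms by (simp add: distinct_pairs_def)
  thus ?thesis by blast
qed

text \<open>The larger root of \<open>(\<lambda> - x) (\<lambda> - y) = x S y T\<close>, the right end of a Brauer oval, is
  at most any upper bound \<open>M\<close> of the two Gershgorin bounds \<open>x (1 + S)\<close> and \<open>y (1 + T)\<close>: then
  \<open>x S y T \<le> (M - x) (M - y)\<close>, and replacing the product on the left by the one on the right
  makes the discriminant the perfect square \<open>(2 M - x - y)\<^sup>2\<close>.\<close>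

lemma brauer_root_le:
  fixes x y S T M :: real
  assumes "0 \<le> x" "0 \<le> y" "0 \<le> S" "0 \<le> T" "(1 + S) * x \<le> M" "(1 + T) * y \<le> M"
  shows "x + y + sqrt ((x - y)\<^sup>2 + 4 * x * y * S * T) \<le> 2 * M"
proof -
  have S: "0 \<le> x * S" "x * S \<le> M - x" and T: "0 \<le> y * T" "y * T \<le> M - y"
    using assms by (simp_all add: algebra_simps)
  have "(x * S) * (y * T) \<le> (M - x) * (M - y)"
    using S T by (intro mult_mono) auto
  hence "(x - y)\<^sup>2 + 4 * x * y * S * T \<le> (2 * M - x - y)\<^sup>2"
    by (simp add: power2_eq_square algebra_simps)
  hence "sqrt ((x - y)\<^sup>2 + 4 * x * y * S * T) \<le> 2 * M - x - y"
    using S T by (intro real_le_lsqrt) auto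
  thus ?thesis by simp
qed

lemma Max_brauer_ge_gershgorin:
  fixes x S :: "nat \<Rightarrow> real"
  assumes n: "n \<ge> 2" and x: "\<And>i. i < n \<Longrightarrow> 0 < x i" and S: "\<And>i. i < n \<Longrightarrow> 0 \<le> S i"
    and M: "\<And>i. i < n \<Longrightarrow> (1 + S i) * x i \<le> M"
  shows "1 / M \<le> 2 / (MAX (i,j)\<in>distinct_pairs n.
           x i + x j + sqrt ((x i - x j)\<^sup>2 + 4 * x i * x j * S i * S j))"
proof -
  have "2 / (MAX (i,j)\<in>distinct_pairs n. 2 * M) \<le> 2 / (MAX (i,j)\<in>distinct_pairs n.
           x i + x j + sqrt ((x i - x j)\<^sup>2 + 4 * x i * x j * S i * S j))"
  proof (rule divide_Max_antimono[OF finite_distinct_pairs distinct_pairs_nonempty[OF n]])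
    fix p assume "p \<in> distinct_pairs n"
    then obtain i j where p: "p = (i, j)" "i < n" "j < n" by (auto simp: distinct_pairs_def)
    have "0 \<le> sqrt ((x i - x j)\<^sup>2 + 4 * x i * x j * S i * S j)"
      using p x S by (simp add: less_imp_le)
    thus "0 < (case p of (i, j) \<Rightarrow>
        x i + x j + sqrt ((x i - x j)\<^sup>2 + 4 * x i * x j * S i * S j))"
      using x[OF p(2)] x[OF p(3)] unfolding p(1) prod.case by linarith
    show "(case p of (i, j) \<Rightarrow>
        x i + x j + sqrt ((x i - x j)\<^sup>2 + 4 * x i * x j * S i * S j)) \<le> (case p of (i, j) \<Rightarrow> 2 * M)"
      using p x S M by (auto intro!: brauer_root_le simp: less_imp_le)
  qed simp
  moreover have "(\<lambda>(i, j). 2 * M) ` distinct_pairs n = {2 * M}"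
    using distinct_pairs_nonempty[OF n] by auto
  ultimately show ?thesis by simp
qed

lemma Max_brauer_mono:
  fixes x y e f S T :: "nat \<Rightarrow> real" and D E :: "nat \<Rightarrow> nat \<Rightarrow> real"
  assumes n: "n \<ge> 2"
    and x: "\<And>i. i < n \<Longrightarrow> 0 < x i \<and> x i \<le> y i"
    and S: "\<And>i. i < n \<Longrightarrow> 0 \<le> S i \<and> S i \<le> \<sigma>"
    and D: "\<And>i j. i < n \<Longrightarrow> j < n \<Longrightarrow> \<bar>D i j\<bar> \<le> \<bar>E i j\<bar>"
  shows "2 / (MAX (i,j)\<in>distinct_pairs n.
           y i + y j + sqrt ((E i j)\<^sup>2 + 4 * y i * y j * \<sigma> * \<sigma>)) \<le>
         2 / (MAX (i,j)\<in>distinct_pairs n.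
           x i + x j + sqrt ((D i j)\<^sup>2 + 4 * x i * x j * S i * S j))"
proof (rule divide_Max_antimono[OF finite_distinct_pairs distinct_pairs_nonempty[OF n]])
  fix p assume "p \<in> distinct_pairs n"
  then obtain i j where p: "p = (i, j)" "i < n" "j < n" by (auto simp: distinct_pairs_def)
  note b = x[OF p(2)] x[OF p(3)] S[OF p(2)] S[OF p(3)]
  have "0 \<le> sqrt ((D i j)\<^sup>2 + 4 * x i * x j * S i * S j)"
    using b by simp
  thus "0 < (case p of (i, j) \<Rightarrow> x i + x j + sqrt ((D i j)\<^sup>2 + 4 * x i * x j * S i * S j))"
    using b unfolding p(1) prod.case by linarith
  have "(D i j)\<^sup>2 \<le> (E i j)\<^sup>2" using D[OF p(2,3)] by (simp add: abs_le_square_iff)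
  moreover have "4 * x i * x j * S i * S j \<le> 4 * y i * y j * \<sigma> * \<sigma>"
    using b by (intro mult_mono) auto
  ultimately have "sqrt ((D i j)\<^sup>2 + 4 * x i * x j * S i * S j)
      \<le> sqrt ((E i j)\<^sup>2 + 4 * y i * y j * \<sigma> * \<sigma>)"
    by simp
  thus "(case p of (i, j) \<Rightarrow> x i + x j + sqrt ((D i j)\<^sup>2 + 4 * x i * x j * S i * S j))
     \<le> (case p of (i, j) \<Rightarrow> y i + y j + sqrt ((E i j)\<^sup>2 + 4 * y i * y j * \<sigma> * \<sigma>))"
    using b unfolding p(1) prod.case by linarith
qed simp

lemma Max_gershgorin_mono:
  fixes x y S :: "nat \<Rightarrow> real"
  assumes n: "n \<ge> 2"
    and x: "\<And>i. i < n \<Longrightarrow> 0 < x i \<and> x i \<le> y i"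
    and S: "\<And>i. i < n \<Longrightarrow> 0 \<le> S i \<and> S i \<le> \<sigma>"
  shows "1 / ((1 + \<sigma>) * (MAX i\<in>{..<n}. y i)) \<le> 1 / (MAX i\<in>{..<n}. (1 + S i) * x i)"
proof -
  have "1 / (MAX i\<in>{..<n}. (1 + \<sigma>) * (MAX i\<in>{..<n}. y i)) \<le> 1 / (MAX i\<in>{..<n}. (1 + S i) * x i)"
  proof (rule divide_Max_antimono)
    fix i assume "i \<in> {..<n}"
    hence i: "i < n" by simp
    show "0 < (1 + S i) * x i"
      using x[OF i] S[OF i] by (simp add: add_pos_nonneg)
    have "x i \<le> (MAX i\<in>{..<n}. y i)"
      using x[OF i] i by (intro order_trans[OF _ Max_ge]) auto
    thus "(1 + S i) * x i \<le> (1 + \<sigma>) * (MAX i\<in>{..<n}. y i)"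
      using x[OF i] S[OF i] by (intro mult_mono) auto
  qed (use n in \<open>auto simp: lessThan_empty_iff\<close>)
  moreover have "(\<lambda>i. (1 + \<sigma>) * (MAX i\<in>{..<n}. y i)) ` {..<n} = {(1 + \<sigma>) * (MAX i\<in>{..<n}. y i)}"
    using n by (auto simp: image_constant_conv lessThan_empty_iff)
  ultimately show ?thesis by simp
qed

section \<open>The iterated weights of a strictly diagonally dominant matrix\<close>

locale strictly_diagonally_dominant =
  fixes n :: nat and A :: "real mat"
  assumes carrier: "A \<in> carrier_mat n n"
    and dominant: "\<And>i. i < n \<Longrightarrow> (\<Sum>j\<in>{..<n} - {i}. \<bar>A $$ (i,j)\<bar>) < \<bar>A $$ (i,i)\<bar>"
begin

lemma dim [simp]: "dim_row A = n"
  using carrier by simp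

lemma diag_pos: "i < n \<Longrightarrow> 0 < \<bar>A $$ (i,i)\<bar>"
  using dominant[of i] sum_nonneg[of "{..<n} - {i}" "\<lambda>j. \<bar>A $$ (i,j)\<bar>"] by linarith

lemma off_diagonal_split:
  fixes f :: "nat \<Rightarrow> real"
  assumes "i < n" "i \<noteq> j"
  shows "(\<Sum>k\<in>{..<n} - {j}. f k) = f i + (\<Sum>k\<in>{..<n} - {j,i}. f k)"
proof -
  have "{..<n} - {j,i} = ({..<n} - {j}) - {i}" by auto
  thus ?thesis using assms sum.remove[of "{..<n} - {j}" i f] by simp
qed

text \<open>A family \<open>w\<close> is a dominating weight if, for each fixed \<open>i\<close>, the column \<open>w\<^sub>j\<^sub>i\<close> is a
  supersolution of the Jacobi fixed point equation
  \<open>\<bar>a\<^sub>j\<^sub>j\<bar> w\<^sub>j\<^sub>i = \<bar>a\<^sub>j\<^sub>i\<bar> + \<Sum> \<bar>a\<^sub>j\<^sub>k\<bar> w\<^sub>k\<^sub>i\<close>. This is the one property that the iteration preserves and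
  that keeps every denominator in it under control.\<close>

definition dominating_weight :: "(nat \<Rightarrow> nat \<Rightarrow> real) \<Rightarrow> bool" where
  "dominating_weight w \<longleftrightarrow> (\<forall>j<n. \<forall>i<n. i \<noteq> j \<longrightarrow> 0 \<le> w j i \<and>
     \<bar>A $$ (j,i)\<bar> + (\<Sum>k\<in>{..<n} - {j,i}. \<bar>A $$ (j,k)\<bar> * w k i) \<le> \<bar>A $$ (j,j)\<bar> * w j i)"

lemma dominating_weightD:
  assumes "dominating_weight w" "j < n" "i < n" "i \<noteq> j"
  shows "0 \<le> w j i"
    and "\<bar>A $$ (j,i)\<bar> + (\<Sum>k\<in>{..<n} - {j,i}. \<bar>A $$ (j,k)\<bar> * w k i) \<le> \<bar>A $$ (j,j)\<bar> * w j i"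
  using assms by (auto simp: dominating_weight_def)

text \<open>The denominator in each quotient defining \<open>h\<^sub>i\<close> is at least its numerator, by the
  supersolution inequality; a vanishing denominator therefore forces a vanishing numerator, and
  the value \<open>0\<close> of such a quotient is compatible with all three claims.\<close>

lemma h_col_bounds:
  assumes w: "dominating_weight w" and ji: "j < n" "i < n" "i \<noteq> j"
  shows "0 \<le> h_col A w i" "h_col A w i \<le> 1"
    and "\<bar>A $$ (j,i)\<bar> \<le> h_col A w i *
      (\<bar>A $$ (j,j)\<bar> * w j i - (\<Sum>k\<in>{..<n} - {j,i}. \<bar>A $$ (j,k)\<bar> * w k i))"
proof -
  define den where
    "den j = \<bar>A $$ (j,j)\<bar> * w j i - (\<Sum>k\<in>{..<n} - {j,i}. \<bar>A $$ (j,k)\<bar> * w k i)" for j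
  define q where "q j = \<bar>A $$ (j,i)\<bar> / den j" for j
  have den: "\<bar>A $$ (j,i)\<bar> \<le> den j" if "j < n" "i \<noteq> j" for j
    using dominating_weightD(2)[OF w that(1) ji(2) that(2)] by (simp add: den_def)
  have h: "h_col A w i = Max (q ` ({..<n} - {i}))"
    by (simp add: h_col_def q_def den_def)
  have q: "0 \<le> q j" "q j \<le> 1" if "j < n" "i \<noteq> j" for j
    using den[OF that] abs_ge_zero[of "A $$ (j,i)"]
    by (auto simp: q_def divide_le_eq_1 intro!: divide_nonneg_nonneg simp del: abs_ge_zero)
  have qh: "q j \<le> h_col A w i"
    unfolding h using ji by (intro Max_ge) auto
  show "0 \<le> h_col A w i" using qh q(1)[OF ji(1,3)] by linarith
  show "h_col A w i \<le> 1"
    unfolding h using ji q(2) by (subst Max_le_iff) auto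
  have "\<bar>A $$ (j,i)\<bar> = q j * den j"
    using den[OF ji(1,3)] by (auto simp: q_def)
  also have "\<dots> \<le> h_col A w i * den j"
    using qh den[OF ji(1,3)] by (intro mult_right_mono) auto
  finally show "\<bar>A $$ (j,i)\<bar> \<le> h_col A w i *
      (\<bar>A $$ (j,j)\<bar> * w j i - (\<Sum>k\<in>{..<n} - {j,i}. \<bar>A $$ (j,k)\<bar> * w k i))"
    by (simp add: den_def)
qed

lemma u_coeff_nonneg:
  assumes w: "dominating_weight w" and ji: "j < n" "i < n" "i \<noteq> j"
  shows "0 \<le> u_coeff A w j i"
  using h_col_bounds(1)[OF assms] dominating_weightD(1)[OF w _ ji(2)]
  by (auto simp: u_coeff_def intro!: divide_nonneg_nonneg add_nonneg_nonneg sum_nonneg mult_nonneg_nonneg)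

text \<open>The number \<open>h\<^sub>i\<close> is the smallest nonnegative factor for which \<open>h\<^sub>i w\<close> still satisfies the
  supersolution inequality in column \<open>i\<close>, and \<open>u\<close> is one Jacobi step from \<open>h\<^sub>i w\<close>.\<close>

lemma u_coeff_le_scaled:
  assumes w: "dominating_weight w" and ji: "j < n" "i < n" "i \<noteq> j"
  shows "u_coeff A w j i \<le> h_col A w i * w j i"
proof -
  have "\<bar>A $$ (j,i)\<bar> + (\<Sum>k\<in>{..<n} - {j,i}. \<bar>A $$ (j,k)\<bar> * w k i * h_col A w i)
      \<le> h_col A w i * w j i * \<bar>A $$ (j,j)\<bar>"
    using h_col_bounds(3)[OF assms]
    by (simp add: sum_distrib_left algebra_simps)
  thus ?thesis using diag_pos[OF ji(1)] by (simp add: u_coeff_def pos_divide_le_eq)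
qed

lemma u_coeff_le:
  assumes w: "dominating_weight w" and ji: "j < n" "i < n" "i \<noteq> j"
  shows "u_coeff A w j i \<le> w j i"
  using u_coeff_le_scaled[OF assms]
    mult_right_mono[OF h_col_bounds(2)[OF assms] dominating_weightD(1)[OF assms]]
  by simp

text \<open>Both sides are Jacobi steps, from \<open>u\<close> and from \<open>h\<^sub>i w\<close>, and the step is monotone.\<close>

lemma p_coeff_u_coeff_le:
  assumes w: "dominating_weight w" and ji: "j < n" "i < n" "i \<noteq> j"
  shows "p_coeff A (u_coeff A w) j i \<le> u_coeff A w j i"
proof -
  have "(\<Sum>k\<in>{..<n} - {j,i}. \<bar>A $$ (j,k)\<bar> * u_coeff A w k i)
      \<le> (\<Sum>k\<in>{..<n} - {j,i}. \<bar>A $$ (j,k)\<bar> * w k i * h_col A w i)"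
  proof (rule sum_mono)
    fix k assume k: "k \<in> {..<n} - {j,i}"
    hence "\<bar>A $$ (j,k)\<bar> * u_coeff A w k i \<le> \<bar>A $$ (j,k)\<bar> * (h_col A w i * w k i)"
      using ji by (intro mult_left_mono u_coeff_le_scaled[OF w]) auto
    thus "\<bar>A $$ (j,k)\<bar> * u_coeff A w k i \<le> \<bar>A $$ (j,k)\<bar> * w k i * h_col A w i"
      by (simp add: mult_ac)
  qed
  thus ?thesis unfolding p_coeff_def u_coeff_def[of A w j i]
    by (auto intro!: divide_right_mono)
qed

text \<open>\<open>p\<close> is one Jacobi step from \<open>u\<close> and does not exceed it, so a further step cannot
  increase \<open>p\<close>.\<close>

lemma dominating_weight_p_coeff:
  assumes w: "dominating_weight w"
  shows "dominating_weight (p_coeff A (u_coeff A w))"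
  unfolding dominating_weight_def
proof (intro allI impI conjI)
  fix j i assume ji: "j < n" "i < n" "i \<noteq> j"
  show "0 \<le> p_coeff A (u_coeff A w) j i"
    using u_coeff_nonneg[OF w _ ji(2)]
    by (auto simp: p_coeff_def intro!: divide_nonneg_nonneg add_nonneg_nonneg sum_nonneg mult_nonneg_nonneg)
  have "(\<Sum>k\<in>{..<n} - {j,i}. \<bar>A $$ (j,k)\<bar> * p_coeff A (u_coeff A w) k i)
      \<le> (\<Sum>k\<in>{..<n} - {j,i}. \<bar>A $$ (j,k)\<bar> * u_coeff A w k i)"
    using ji by (intro sum_mono mult_left_mono p_coeff_u_coeff_le[OF w]) auto
  moreover have "\<bar>A $$ (j,j)\<bar> * p_coeff A (u_coeff A w) j i
      = \<bar>A $$ (j,i)\<bar> + (\<Sum>k\<in>{..<n} - {j,i}. \<bar>A $$ (j,k)\<bar> * u_coeff A w k i)"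
    using diag_pos[OF ji(1)] by (simp add: p_coeff_def)
  ultimately show "\<bar>A $$ (j,i)\<bar> + (\<Sum>k\<in>{..<n} - {j,i}. \<bar>A $$ (j,k)\<bar> * p_coeff A (u_coeff A w) k i)
      \<le> \<bar>A $$ (j,j)\<bar> * p_coeff A (u_coeff A w) j i"
    by simp
qed

text \<open>Strict dominance of row \<open>j\<close> says exactly that the \<open>j\<close>-th quotient in \<open>r\<^sub>i\<close> has a
  denominator larger than its numerator.\<close>

lemma r_col_bounds:
  assumes ji: "j < n" "i < n" "i \<noteq> j"
  shows "0 \<le> r_col A i" "r_col A i \<le> 1"
    and "\<bar>A $$ (j,i)\<bar> \<le>
      r_col A i * (\<bar>A $$ (j,j)\<bar> - (\<Sum>k\<in>{..<n} - {j,i}. \<bar>A $$ (j,k)\<bar>))"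
proof -
  define den where "den j = \<bar>A $$ (j,j)\<bar> - (\<Sum>k\<in>{..<n} - {j,i}. \<bar>A $$ (j,k)\<bar>)" for j
  define q where "q j = \<bar>A $$ (j,i)\<bar> / den j" for j
  have den: "\<bar>A $$ (j,i)\<bar> < den j" if "j < n" "i \<noteq> j" for j
    using dominant[OF that(1)] off_diagonal_split[OF ji(2) that(2), of "\<lambda>k. \<bar>A $$ (j,k)\<bar>"]
    by (simp add: den_def)
  have den_pos: "0 < den j" if "j < n" "i \<noteq> j" for j
    using den[OF that] by (rule le_less_trans[OF abs_ge_zero])
  have r: "r_col A i = Max (q ` ({..<n} - {i}))"
    by (simp add: r_col_def q_def den_def)
  have q: "0 \<le> q j" "q j \<le> 1" if "j < n" "i \<noteq> j" for j
    using den[OF that] den_pos[OF that] by (auto simp: q_def)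
  have qr: "q j \<le> r_col A i"
    unfolding r using ji by (intro Max_ge) auto
  show "0 \<le> r_col A i" using qr q(1)[OF ji(1,3)] by linarith
  show "r_col A i \<le> 1"
    unfolding r using ji q(2) by (subst Max_le_iff) auto
  have "\<bar>A $$ (j,i)\<bar> \<le> r_col A i * den j"
    using qr den_pos[OF ji(1,3)] by (simp add: q_def pos_divide_le_eq)
  thus "\<bar>A $$ (j,i)\<bar> \<le>
      r_col A i * (\<bar>A $$ (j,j)\<bar> - (\<Sum>k\<in>{..<n} - {j,i}. \<bar>A $$ (j,k)\<bar>))"
    by (simp add: den_def)
qed

lemma m_coeff_le_r_col:
  assumes ji: "j < n" "i < n" "i \<noteq> j"
  shows "m_coeff A j i \<le> r_col A i"
proof -
  have "\<bar>A $$ (j,i)\<bar> + (\<Sum>k\<in>{..<n} - {j,i}. \<bar>A $$ (j,k)\<bar> * r_col A i) \<le> r_col A i * \<bar>A $$ (j,j)\<bar>"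
    using r_col_bounds(3)[OF ji] by (simp add: sum_distrib_left algebra_simps)
  thus ?thesis using diag_pos[OF ji(1)] by (simp add: m_coeff_def pos_divide_le_eq)
qed

text \<open>The constant column \<open>r\<^sub>i\<close> is a supersolution, and \<open>m\<close> is one Jacobi step from it.\<close>

lemma dominating_weight_m_coeff: "dominating_weight (m_coeff A)"
  unfolding dominating_weight_def
proof (intro allI impI conjI)
  fix j i assume ji: "j < n" "i < n" "i \<noteq> j"
  show "0 \<le> m_coeff A j i"
    using r_col_bounds(1)[OF ji]
    by (auto simp: m_coeff_def intro!: divide_nonneg_nonneg add_nonneg_nonneg sum_nonneg mult_nonneg_nonneg)
  have "(\<Sum>k\<in>{..<n} - {j,i}. \<bar>A $$ (j,k)\<bar> * m_coeff A k i)
      \<le> (\<Sum>k\<in>{..<n} - {j,i}. \<bar>A $$ (j,k)\<bar> * r_col A i)"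
    using ji by (intro sum_mono mult_left_mono m_coeff_le_r_col) auto
  moreover have "\<bar>A $$ (j,j)\<bar> * m_coeff A j i
      = \<bar>A $$ (j,i)\<bar> + (\<Sum>k\<in>{..<n} - {j,i}. \<bar>A $$ (j,k)\<bar> * r_col A i)"
    using diag_pos[OF ji(1)] by (simp add: m_coeff_def)
  ultimately show "\<bar>A $$ (j,i)\<bar> + (\<Sum>k\<in>{..<n} - {j,i}. \<bar>A $$ (j,k)\<bar> * m_coeff A k i)
      \<le> \<bar>A $$ (j,j)\<bar> * m_coeff A j i"
    by simp
qed

lemma m_coeff_le_d_row:
  assumes ji: "j < n" "i < n" "i \<noteq> j"
  shows "m_coeff A j i \<le> d_row A j"
proof -
  have "(\<Sum>k\<in>{..<n} - {j,i}. \<bar>A $$ (j,k)\<bar> * r_col A i) \<le> (\<Sum>k\<in>{..<n} - {j,i}. \<bar>A $$ (j,k)\<bar>)"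
    using r_col_bounds(2)[OF ji] by (intro sum_mono) (simp add: mult_left_le)
  thus ?thesis
    using off_diagonal_split[OF ji(2,3), of "\<lambda>k. \<bar>A $$ (j,k)\<bar>"]
    by (auto simp: m_coeff_def d_row_def intro!: divide_right_mono)
qed

text \<open>The weight \<open>w\<close> is \<open>m\<close> for \<open>t = 0\<close> and \<open>p\<^bsup>(t)\<^esup>\<close> afterwards.\<close>

lemma u_iter_eq_u_coeff:
  "\<exists>w. u_iter A t = u_coeff A w \<and> dominating_weight w \<and>
     (\<forall>j<n. \<forall>i<n. i \<noteq> j \<longrightarrow> w j i \<le> m_coeff A j i)"
proof (induction t)
  case 0
  show ?case using dominating_weight_m_coeff by (intro exI[of _ "m_coeff A"]) auto
next
  case (Suc t)
  then obtain w where w: "u_iter A t = u_coeff A w" "dominating_weight w"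
      "\<And>j i. j < n \<Longrightarrow> i < n \<Longrightarrow> i \<noteq> j \<Longrightarrow> w j i \<le> m_coeff A j i"
    by blast
  have "p_coeff A (u_iter A t) j i \<le> m_coeff A j i" if "j < n" "i < n" "i \<noteq> j" for j i
    using p_coeff_u_coeff_le[OF w(2) that] u_coeff_le[OF w(2) that] w(3)[OF that]
    by (simp add: w(1))
  thus ?case using dominating_weight_p_coeff[OF w(2)] w(1)
    by (intro exI[of _ "p_coeff A (u_iter A t)"]) auto
qed

lemma p_iter_bounds:
  assumes ji: "j < n" "i < n" "i \<noteq> j"
  shows "\<bar>A $$ (j,i)\<bar> / \<bar>A $$ (j,j)\<bar> \<le> p_iter A t j i" "p_iter A t j i \<le> d_row A j"
proof -
  obtain w where w: "u_iter A (t - 1) = u_coeff A w" "dominating_weight w"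
      "\<And>j i. j < n \<Longrightarrow> i < n \<Longrightarrow> i \<noteq> j \<Longrightarrow> w j i \<le> m_coeff A j i"
    using u_iter_eq_u_coeff[of "t - 1"] by blast
  have "0 \<le> (\<Sum>k\<in>{..<n} - {j,i}. \<bar>A $$ (j,k)\<bar> * u_coeff A w k i)"
    using u_coeff_nonneg[OF w(2) _ ji(2)] by (auto intro!: sum_nonneg mult_nonneg_nonneg)
  thus "\<bar>A $$ (j,i)\<bar> / \<bar>A $$ (j,j)\<bar> \<le> p_iter A t j i"
    unfolding p_iter_def w(1) p_coeff_def dim by (intro divide_right_mono) auto
  show "p_iter A t j i \<le> d_row A j"
    using p_coeff_u_coeff_le[OF w(2) ji] u_coeff_le[OF w(2) ji] w(3)[OF ji] m_coeff_le_d_row[OF ji]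
    unfolding p_iter_def w(1) by linarith
qed

lemma p_iter_nonneg: "j < n \<Longrightarrow> i < n \<Longrightarrow> i \<noteq> j \<Longrightarrow> 0 \<le> p_iter A t j i"
  using p_iter_bounds(1)[of j i t] by (rule order_trans[rotated]) auto

lemma d_row_bounds:
  assumes "i < n"
  shows "0 \<le> d_row A i" "d_row A i < 1" "d_row A i \<le> d_max A"
proof -
  show "0 \<le> d_row A i" by (simp add: d_row_def sum_nonneg)
  show "d_row A i < 1" using dominant[OF assms] diag_pos[OF assms] by (simp add: d_row_def)
  show "d_row A i \<le> d_max A" using assms by (auto simp: d_max_def)
qed

lemma p_iter_column_sum_bounds:
  assumes "i < n"
  shows "0 \<le> (\<Sum>k\<in>{..<n} - {i}. p_iter A t k i)"
    and "(\<Sum>k\<in>{..<n} - {i}. p_iter A t k i) \<le> (real n - 1) * d_max A"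
proof -
  show "0 \<le> (\<Sum>k\<in>{..<n} - {i}. p_iter A t k i)"
    using assms by (auto intro!: sum_nonneg p_iter_nonneg)
  have "(\<Sum>k\<in>{..<n} - {i}. p_iter A t k i) \<le> (\<Sum>k\<in>{..<n} - {i}. d_max A)"
    using assms by (intro sum_mono order_trans[OF p_iter_bounds(2) d_row_bounds(3)]) auto
  thus "(\<Sum>k\<in>{..<n} - {i}. p_iter A t k i) \<le> (real n - 1) * d_max A"
    using assms by (simp add: of_nat_diff)
qed

end

section \<open>Comparison of the reciprocals \<open>phi\<close> and \<open>varphi\<close>\<close>

locale strictly_diagonally_dominant_M_matrix = strictly_diagonally_dominant +
  assumes diag_nonneg: "\<And>i. i < n \<Longrightarrow> 0 \<le> A $$ (i,i)"
    and off_diag_nonpos: "\<And>i j. i < n \<Longrightarrow> j < n \<Longrightarrow> i \<noteq> j \<Longrightarrow> A $$ (i,j) \<le> 0"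
begin

lemma diag_gt_0: "i < n \<Longrightarrow> 0 < A $$ (i,i)"
  using diag_pos[of i] diag_nonneg[of i] by simp

lemma varphi_denominator_pos:
  assumes "i < n"
  shows "0 < A $$ (i,i) - (\<Sum>k\<in>{..<n} - {i}. \<bar>A $$ (i,k)\<bar> * d_row A k)"
proof -
  have "(\<Sum>k\<in>{..<n} - {i}. \<bar>A $$ (i,k)\<bar> * d_row A k) \<le> (\<Sum>k\<in>{..<n} - {i}. \<bar>A $$ (i,k)\<bar>)"
    by (intro sum_mono mult_left_le less_imp_le[OF d_row_bounds(2)]) auto
  thus ?thesis using dominant[OF assms] diag_gt_0[OF assms] by simp
qed

definition second_order_bound :: "nat \<Rightarrow> real" where
  "second_order_bound i =
     1 / (A $$ (i,i) - (\<Sum>k\<in>{..<n} - {i}. A $$ (i,k) * A $$ (k,i) / A $$ (k,k)))"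

text \<open>The four numbers compared are reciprocals of \<open>a\<^sub>i\<^sub>i - \<Sum> \<bar>a\<^sub>i\<^sub>k\<bar> x\<^sub>k\<close>, with \<open>x\<^sub>k\<close> in turn
  equal to \<open>0\<close>, \<open>\<bar>a\<^sub>k\<^sub>i\<bar> / a\<^sub>k\<^sub>k\<close>, \<open>p\<^sub>k\<^sub>i\<^bsup>(t)\<^esup>\<close> and \<open>d\<^sub>k\<close>. These weights increase, so the
  denominators decrease, and even the last of them is positive.\<close>

lemma reciprocal_chain:
  assumes i: "i < n"
  shows "1 / A $$ (i,i) \<le> second_order_bound i" "second_order_bound i \<le> phi A t i"
    "0 < phi A t i" "phi A t i \<le> varphi A i"
proof -
  define f where "f x = A $$ (i,i) - (\<Sum>k\<in>{..<n} - {i}. \<bar>A $$ (i,k)\<bar> * x k)" for x :: "nat \<Rightarrow> real"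
  define q where "q k = \<bar>A $$ (k,i)\<bar> / \<bar>A $$ (k,k)\<bar>" for k
  have anti: "f y \<le> f x" if "\<And>k. k < n \<Longrightarrow> k \<noteq> i \<Longrightarrow> x k \<le> y k" for x y
    unfolding f_def using that by (intro diff_left_mono sum_mono mult_left_mono) auto
  have zero: "f (\<lambda>k. 0) = A $$ (i,i)" by (simp add: f_def)
  have two: "second_order_bound i = 1 / f q"
  proof -
    have "A $$ (i,k) * A $$ (k,i) / A $$ (k,k) = \<bar>A $$ (i,k)\<bar> * q k" if "k < n" "k \<noteq> i" for k
      using that i off_diag_nonpos[of i k] off_diag_nonpos[of k i] diag_gt_0[of k]
      by (simp add: q_def)
    hence "(\<Sum>k\<in>{..<n} - {i}. A $$ (i,k) * A $$ (k,i) / A $$ (k,k))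
        = (\<Sum>k\<in>{..<n} - {i}. \<bar>A $$ (i,k)\<bar> * q k)"
      by (intro sum.cong) auto
    thus ?thesis by (simp add: second_order_bound_def f_def)
  qed
  have three: "phi A t i = 1 / f (\<lambda>k. p_iter A t k i)" by (simp add: phi_def f_def)
  have four: "varphi A i = 1 / f (d_row A)" by (simp add: varphi_def f_def)
  have pos: "0 < f (d_row A)" using varphi_denominator_pos[OF i] by (simp add: f_def)
  have c1: "f q \<le> f (\<lambda>k. 0)" by (rule anti) (simp add: q_def)
  have c2: "f (\<lambda>k. p_iter A t k i) \<le> f q"
    using i p_iter_bounds(1) by (intro anti) (auto simp: q_def)
  have c3: "f (d_row A) \<le> f (\<lambda>k. p_iter A t k i)"
    using i p_iter_bounds(2) by (intro anti) auto
  show "1 / A $$ (i,i) \<le> second_order_bound i"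
    unfolding two zero[symmetric] using pos c1 c2 c3 by (intro divide_left_mono) auto
  show "second_order_bound i \<le> phi A t i"
    unfolding two three using pos c2 c3 by (intro divide_left_mono) auto
  show "0 < phi A t i" unfolding three using pos c3 by simp
  show "phi A t i \<le> varphi A i"
    unfolding three four using pos c3 by (intro divide_left_mono) auto
qed

text \<open>Passing from \<open>phi2\<close> to \<open>varphi2\<close> raises the maximum and lowers the minimum. That \<open>phi2\<close>
  is nonnegative, so that squares can be compared, is the second link of the chain.\<close>

lemma abs_phi2_le_varphi2:
  assumes "i < n" "j < n"
  shows "\<bar>phi2 A t i j\<bar> \<le> \<bar>varphi2 A i j\<bar>"
proof -
  have "phi2 A t i j = max (phi A t i) (phi A t j)
      - min (second_order_bound i) (second_order_bound j)"
    by (simp add: phi2_def second_order_bound_def)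
  thus ?thesis
    using reciprocal_chain(1)[OF assms(1)] reciprocal_chain(1)[OF assms(2)]
      reciprocal_chain(2,4)[OF assms(1), of t] reciprocal_chain(2,4)[OF assms(2), of t]
    unfolding varphi2_def by linarith
qed

theorem Omega_tilde_ge:
  assumes "n \<ge> 2"
  shows "1 / ((1 + (real n - 1) * d_max A) * (MAX i\<in>{..<n}. varphi A i)) \<le> Omega_tilde A t"
  unfolding Omega_tilde_def dim
  by (rule Max_gershgorin_mono[OF assms])
     (use reciprocal_chain p_iter_column_sum_bounds in auto)

theorem Gamma_tilde_ge:
  assumes "n \<ge> 2"
  shows "2 / (MAX (i,j)\<in>distinct_pairs n. varphi A i + varphi A j +
       sqrt ((varphi2 A i j)\<^sup>2 + 4 * (real n - 1)\<^sup>2 * varphi A i * varphi A j * (d_max A)\<^sup>2))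
     \<le> Gamma_tilde A t"
proof -
  \<comment> \<open>Exhibits \<open>(n - 1) d\<close> as the constant bound that replaces both column sums.\<close>
  have eq: "4 * (real n - 1)\<^sup>2 * x * y * r\<^sup>2 = 4 * x * y * ((real n - 1) * r) * ((real n - 1) * r)"
    for x y r :: real
    by (simp add: power2_eq_square)
  show ?thesis
    unfolding Gamma_tilde_def dim eq
    by (rule Max_brauer_mono[OF assms])
       (use reciprocal_chain p_iter_column_sum_bounds abs_phi2_le_varphi2 in auto)
qed

end

section \<open>Row sums, the spectral radius and the inverse\<close>

text \<open>The all-ones vector is an eigenvector for the common row sum.\<close>

lemma row_sum_le_spectral_radius:
  fixes J :: "real mat"
  assumes J: "J \<in> carrier_mat n n" and n: "n > 0" and sums: "\<And>i. i < n \<Longrightarrow> (\<Sum>j<n. J $$ (i,j)) = c"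
  shows "c \<le> real_spectral_radius J"
proof -
  let ?J = "map_mat complex_of_real J" and ?e = "vec n (\<lambda>_. 1 :: complex)"
  have "eigenvector ?J ?e (of_real c)"
    unfolding eigenvector_def
  proof (intro conjI)
    show "?e \<in> carrier_vec (dim_row ?J)" using J by auto
    have "?e $ 0 \<noteq> 0\<^sub>v n $ 0" using n by simp
    thus "?e \<noteq> 0\<^sub>v (dim_row ?J)" using J by auto
    show "?J *\<^sub>v ?e = of_real c \<cdot>\<^sub>v ?e"
    proof (rule eq_vecI)
      fix i assume "i < dim_vec (of_real c \<cdot>\<^sub>v ?e)"
      hence i: "i < n" by simp
      have "(?J *\<^sub>v ?e) $ i = (\<Sum>j<n. complex_of_real (J $$ (i,j)))"
        using i J by (auto simp: scalar_prod_def lessThan_atLeast0 intro!: sum.cong)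
      also have "\<dots> = of_real c" using sums[OF i] by (simp flip: of_real_sum)
      finally show "(?J *\<^sub>v ?e) $ i = (of_real c \<cdot>\<^sub>v ?e) $ i" using i by simp
    qed (use J in auto)
  qed
  hence "of_real c \<in> spectrum ?J" by (auto simp: spectrum_def eigenvalue_def)
  hence "norm (complex_of_real c) \<le> spectral_radius ?J"
    using J n by (intro spectral_radius_mem_max(2)[of _ n] imageI) auto
  thus ?thesis by (simp add: real_spectral_radius_def)
qed

lemma jacobi_matrix_entry:
  assumes A: "A \<in> carrier_mat n n" and ij: "i < n" "j < n"
  shows "jacobi_matrix A $$ (i,j) = (if i = j then 0 else - A $$ (i,j) / A $$ (i,i))"
proof -
  have "mat_diag n (\<lambda>i. A $$ (i,i)) - A \<in> carrier_mat n n"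
    using A by auto
  hence "jacobi_matrix A = mat n n (\<lambda>(i, j). inverse (A $$ (i,i)) *
      (mat_diag n (\<lambda>i. A $$ (i,i)) - A) $$ (i,j))"
    using A by (simp add: jacobi_matrix_def mat_diag_mult_left)
  thus ?thesis using A ij by (simp add: mat_diag_def field_simps)
qed

text \<open>With the all-ones vector \<open>e\<close>, the hypothesis \<open>B e = e\<close> gives \<open>A e = A (B e) = e\<close>.\<close>

lemma inverse_row_sums:
  fixes A B :: "real mat"
  assumes A: "A \<in> carrier_mat n n" and B: "B \<in> carrier_mat n n" and AB: "A * B = 1\<^sub>m n"
    and rows: "\<And>i. i < n \<Longrightarrow> (\<Sum>j<n. B $$ (i,j)) = 1" and i: "i < n"
  shows "(\<Sum>j<n. A $$ (i,j)) = 1"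
proof -
  have entry: "(\<Sum>j<n. A $$ (i,j) * B $$ (j,k)) = (if i = k then 1 else 0)" if "k < n" for k
  proof -
    have "(A * B) $$ (i,k) = (\<Sum>j<n. A $$ (i,j) * B $$ (j,k))"
      using A B i that by (auto simp: scalar_prod_def lessThan_atLeast0 intro!: sum.cong)
    thus ?thesis using AB i that by simp
  qed
  have "(\<Sum>j<n. A $$ (i,j)) = (\<Sum>j<n. A $$ (i,j) * (\<Sum>k<n. B $$ (j,k)))"
    using rows by simp
  also have "\<dots> = (\<Sum>k<n. \<Sum>j<n. A $$ (i,j) * B $$ (j,k))"
    by (simp add: sum_distrib_left) (rule sum.swap)
  also have "\<dots> = 1" using i by (simp add: entry)
  finally show ?thesis .
qed

text \<open>In row \<open>i\<close> of \<open>A B = I\<close> the off-diagonal terms are nonpositive, so that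
  \<open>a\<^sub>i\<^sub>i b\<^sub>i\<^sub>i \<ge> 1\<close>.\<close>

lemma M_matrix_inverse_diag_pos:
  fixes A B :: "real mat"
  assumes A: "A \<in> carrier_mat n n" and B: "B \<in> carrier_mat n n" and AB: "A * B = 1\<^sub>m n"
    and off: "\<And>i j. i < n \<Longrightarrow> j < n \<Longrightarrow> i \<noteq> j \<Longrightarrow> A $$ (i,j) \<le> 0"
    and nonneg: "\<And>i j. i < n \<Longrightarrow> j < n \<Longrightarrow> 0 \<le> B $$ (i,j)" and i: "i < n"
  shows "0 < B $$ (i,i)"
proof -
  have "(A * B) $$ (i,i) = (\<Sum>j<n. A $$ (i,j) * B $$ (j,i))"
    using A B i by (auto simp: scalar_prod_def lessThan_atLeast0 intro!: sum.cong)
  also have "\<dots> = A $$ (i,i) * B $$ (i,i) + (\<Sum>j\<in>{..<n} - {i}. A $$ (i,j) * B $$ (j,i))"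
    using i by (subst sum.remove[of _ i]) auto
  finally have "1 = A $$ (i,i) * B $$ (i,i) + (\<Sum>j\<in>{..<n} - {i}. A $$ (i,j) * B $$ (j,i))"
    using AB i by simp
  moreover have "(\<Sum>j\<in>{..<n} - {i}. A $$ (i,j) * B $$ (j,i)) \<le> 0"
    using i off nonneg by (intro sum_nonpos) (auto intro!: mult_nonpos_nonneg)
  ultimately have "B $$ (i,i) \<noteq> 0" by auto
  thus ?thesis using nonneg[OF i i] by simp
qed

section \<open>Doubly stochastic inverses\<close>

theorem theorem8:
  fixes n t :: nat and A B :: "real mat"
  assumes "n \<ge> 2"
    and "A \<in> nonsingular_M_matrices n"
    and "\<forall>i<n. \<forall>j<n. A $$ (i,i) = A $$ (j,j)"
    and "B \<in> carrier_mat n n" and "inverts_mat A B" and "inverts_mat B A"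
    and "doubly_stochastic B"
    and "t \<ge> 1"
  shows "(Gamma_bound A B t \<ge> Omega_bound A B t \<and>
         Omega_bound A B t \<ge>
           1 / ((1 + (real n - 1) * real_spectral_radius (jacobi_matrix A)) *
                (MAX i\<in>{..<n}. B $$ (i,i)))) \<and>
         (Gamma_bound A B t \<ge>
           2 / (MAX (i,j)\<in>distinct_pairs n.
             B $$ (i,i) + B $$ (j,j) +
             sqrt ((B $$ (i,i) - B $$ (j,j))\<^sup>2 +
                   4 * (real n - 1)\<^sup>2 * B $$ (i,i) * B $$ (j,j) *
                   (real_spectral_radius (jacobi_matrix A))\<^sup>2)) \<and>
         2 / (MAX (i,j)\<in>distinct_pairs n.
             B $$ (i,i) + B $$ (j,j) +
             sqrt ((B $$ (i,i) - B $$ (j,j))\<^sup>2 +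
                   4 * (real n - 1)\<^sup>2 * B $$ (i,i) * B $$ (j,j) *
                   (real_spectral_radius (jacobi_matrix A))\<^sup>2)) \<ge>
           1 / ((1 + (real n - 1) * real_spectral_radius (jacobi_matrix A)) *
                (MAX i\<in>{..<n}. B $$ (i,i)))) \<and>
         (Omega_tilde A t \<ge>
           1 / ((1 + (real n - 1) * d_max A) * (MAX i\<in>{..<n}. varphi A i))) \<and>
         (Gamma_tilde A t \<ge>
           2 / (MAX (i,j)\<in>distinct_pairs n.
             varphi A i + varphi A j +
             sqrt ((varphi2 A i j)\<^sup>2 +
                   4 * (real n - 1)\<^sup>2 * varphi A i * varphi A j * (d_max A)\<^sup>2)))"
proof -
  define r where "r = real_spectral_radius (jacobi_matrix A)"
  define S where "S i = (\<Sum>k\<in>{..<n} - {i}. p_iter A t k i)" for i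
  have A: "A \<in> carrier_mat n n"
    and off: "\<And>i j. i < n \<Longrightarrow> j < n \<Longrightarrow> i \<noteq> j \<Longrightarrow> A $$ (i,j) \<le> 0"
    using assms(2) by (auto simp: nonsingular_M_matrices_def)
  have AB: "A * B = 1\<^sub>m n" using assms(5) A by (simp add: inverts_mat_def)
  have B_nonneg: "\<And>i j. i < n \<Longrightarrow> j < n \<Longrightarrow> 0 \<le> B $$ (i,j)"
    and B_rows: "\<And>i. i < n \<Longrightarrow> (\<Sum>j<n. B $$ (i,j)) = 1"
    using assms(4,7) by (auto simp: doubly_stochastic_def nonneg_matrix_def)
  have B_pos: "0 < B $$ (i,i)" if "i < n" for i
    by (rule M_matrix_inverse_diag_pos[OF A assms(4) AB off B_nonneg that])
  have diag: "A $$ (i,i) = 1 + (\<Sum>j\<in>{..<n} - {i}. \<bar>A $$ (i,j)\<bar>)" if i: "i < n" for i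
  proof -
    have "(\<Sum>j<n. A $$ (i,j)) = 1" by (rule inverse_row_sums[OF A assms(4) AB B_rows i])
    moreover have "(\<Sum>j<n. A $$ (i,j)) = A $$ (i,i) + (\<Sum>j\<in>{..<n} - {i}. A $$ (i,j))"
      using i by (subst sum.remove[of _ i]) auto
    moreover have "(\<Sum>j\<in>{..<n} - {i}. A $$ (i,j)) = (\<Sum>j\<in>{..<n} - {i}. - \<bar>A $$ (i,j)\<bar>)"
      using i off[OF i] by (intro sum.cong) auto
    ultimately show ?thesis by (simp add: sum_negf)
  qed
  have diag_ge: "1 \<le> A $$ (i,i)" if "i < n" for i
    using diag[OF that] by (simp add: sum_nonneg)
  interpret strictly_diagonally_dominant_M_matrix n A
  proof
    show "A \<in> carrier_mat n n" by (rule A)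
    show "(\<Sum>j\<in>{..<n} - {i}. \<bar>A $$ (i,j)\<bar>) < \<bar>A $$ (i,i)\<bar>" if "i < n" for i
      using diag[OF that] by linarith
    show "0 \<le> A $$ (i,i)" if "i < n" for i using diag_ge[OF that] by simp
  qed (rule off)
  have d_row_const: "d_row A i = 1 - 1 / A $$ (0,0)" if i: "i < n" for i
  proof -
    have "0 < n" using assms(1) by linarith
    hence "A $$ (i,i) = A $$ (0,0)" using assms(3) i by blast
    hence "(\<Sum>j\<in>{..<n} - {i}. \<bar>A $$ (i,j)\<bar>) = A $$ (0,0) - 1" "0 < A $$ (0,0)"
      "\<bar>A $$ (i,i)\<bar> = A $$ (0,0)"
      using diag[OF i] diag_ge[OF i] by auto
    thus ?thesis by (simp add: d_row_def diff_divide_distrib)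
  qed
  have "d_max A = Max ((\<lambda>i. 1 - 1 / A $$ (0,0)) ` {..<n})"
    unfolding d_max_def dim using d_row_const by (intro arg_cong[of _ _ Max] image_cong) auto
  also have "(\<lambda>i. 1 - 1 / A $$ (0,0)) ` {..<n} = {1 - 1 / A $$ (0,0)}"
    using assms(1) by (auto simp: image_constant_conv lessThan_empty_iff)
  finally have d_max: "d_row A i = d_max A" if "i < n" for i using d_row_const[OF that] by simp
  have jacobi_sums: "(\<Sum>j<n. jacobi_matrix A $$ (i,j)) = d_max A" if i: "i < n" for i
  proof -
    have "(\<Sum>j<n. jacobi_matrix A $$ (i,j))
        = (\<Sum>j<n. if i = j then 0 else - A $$ (i,j) / A $$ (i,i))"
      using jacobi_matrix_entry[OF A i] by (intro sum.cong) auto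
    also have "\<dots> = (\<Sum>j\<in>{..<n} - {i}. - A $$ (i,j) / A $$ (i,i))"
      using i by (subst sum.remove[of _ i]) (auto intro!: sum.cong)
    also have "\<dots> = (\<Sum>j\<in>{..<n} - {i}. \<bar>A $$ (i,j)\<bar> / \<bar>A $$ (i,i)\<bar>)"
      using i off[OF i] diag_ge[OF i] by (intro sum.cong) auto
    also have "\<dots> = d_row A i" by (simp add: d_row_def sum_divide_distrib)
    finally show ?thesis using d_max[OF i] by simp
  qed
  have "jacobi_matrix A \<in> carrier_mat n n"
    using A by (auto simp: jacobi_matrix_def mat_diag_def)
  hence d_le: "d_max A \<le> r"
    unfolding r_def using assms(1) jacobi_sums by (intro row_sum_le_spectral_radius[of _ n]) auto
  have d_nonneg: "0 \<le> d_max A" using d_row_bounds(1)[of 0] d_max[of 0] assms(1) by simp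
  have S: "0 \<le> S i \<and> S i \<le> (real n - 1) * r" if "i < n" for i
  proof -
    have "(real n - 1) * d_max A \<le> (real n - 1) * r"
      using assms(1) d_le by (intro mult_left_mono) auto
    thus ?thesis using p_iter_column_sum_bounds[OF that, of t] unfolding S_def by linarith
  qed
  \<comment> \<open>Brings the second Brauer expression to the shape of the first, with \<open>S\<close> constant.\<close>
  have eq: "4 * (real n - 1)\<^sup>2 * x * y * r\<^sup>2 = 4 * x * y * ((real n - 1) * r) * ((real n - 1) * r)"
    for x y :: real
    by (simp add: power2_eq_square)
  have Gamma: "Gamma_bound A B t = 2 / (MAX (i,j)\<in>distinct_pairs n.
      B $$ (i,i) + B $$ (j,j) + sqrt ((B $$ (i,i) - B $$ (j,j))\<^sup>2 +
        4 * B $$ (i,i) * B $$ (j,j) * S i * S j))"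
    by (simp add: Gamma_bound_def S_def)
  have Omega: "Omega_bound A B t = 1 / (MAX i\<in>{..<n}. (1 + S i) * B $$ (i,i))"
    by (simp add: Omega_bound_def S_def)
  have a1: "Omega_bound A B t \<le> Gamma_bound A B t"
    unfolding Gamma Omega using assms(1) B_pos S
    by (intro Max_brauer_ge_gershgorin) (auto intro!: Max_ge)
  have a2: "1 / ((1 + (real n - 1) * r) * (MAX i\<in>{..<n}. B $$ (i,i))) \<le> Omega_bound A B t"
    unfolding Omega using assms(1) B_pos S by (intro Max_gershgorin_mono) auto
  have b1: "2 / (MAX (i,j)\<in>distinct_pairs n. B $$ (i,i) + B $$ (j,j) +
      sqrt ((B $$ (i,i) - B $$ (j,j))\<^sup>2 + 4 * (real n - 1)\<^sup>2 * B $$ (i,i) * B $$ (j,j) * r\<^sup>2))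
      \<le> Gamma_bound A B t"
    unfolding Gamma eq using assms(1) B_pos S by (intro Max_brauer_mono) auto
  have b2: "1 / ((1 + (real n - 1) * r) * (MAX i\<in>{..<n}. B $$ (i,i)))
      \<le> 2 / (MAX (i,j)\<in>distinct_pairs n. B $$ (i,i) + B $$ (j,j) +
        sqrt ((B $$ (i,i) - B $$ (j,j))\<^sup>2 + 4 * (real n - 1)\<^sup>2 * B $$ (i,i) * B $$ (j,j) * r\<^sup>2))"
    unfolding eq using assms(1) B_pos d_nonneg d_le
    by (intro Max_brauer_ge_gershgorin) (auto intro!: mult_left_mono Max_ge)
  show ?thesis
    using a1 a2 b1 b2 Omega_tilde_ge[OF assms(1), of t] Gamma_tilde_ge[OF assms(1), of t]
    unfolding r_def by blast
qed

end
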